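(* Let $n\ge 1$ and let $A^1,A^2,\ldots,A^n$ be finite simple graphs containing no isolated vertices. Then \[ \prod_{i=1}^{n}\gamma_t(A^i) \le n\,\gamma_t(A^1\Box A^2\Box\cdots\Box A^n). \]
   Context: All graphs are finite, simple and undirected. For a graph $G$ and vertex $v$, $N_G(v)$ denotes the open neighborhood of $v$. A total dominating set of $G$ is a set $D\subseteq V(G)$ with $N_G(v)\cap D\neq\emptyset$ for all $v\in V(G)$; $\gamma_t(G)$ is the minimum size of a total dominating set. The Cartesian product $A^1\Box\cdots\Box A^n$ has vertex set $V(A^1)\times\cdots\times V(A^n)$, with $u^1\cdots u^n$ and $v^1\cdots v^n$ adjacent iff for some index $i$, $u^iv^i\in E(A^i)$ and $u^j=v^j$ for all $j\neq i$. *)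

theory Defs
  imports "Graph_Theory.Pair_Digraph" "HOL-Library.FuncSet"
begin

text \<open>
  A finite simple undirected graph is a \<open>pair_graph\<close>: a finite, loop-free, symmetric arc relation
  in which the edge \<open>uv\<close> is represented by the two arcs \<open>(u, v)\<close> and \<open>(v, u)\<close>.
  As in the library, the null graph is admitted.
\<close>

definition open_neighborhood :: "'a pair_pre_digraph \<Rightarrow> 'a \<Rightarrow> 'a set" where
  "open_neighborhood G v = {u \<in> pverts G. (v, u) \<in> parcs G}"

definition no_isolated_vertices :: "'a pair_pre_digraph \<Rightarrow> bool" where
  "no_isolated_vertices G \<longleftrightarrow> (\<forall>v \<in> pverts G. open_neighborhood G v \<noteq> {})"

definition total_dominating_set :: "'a pair_pre_digraph \<Rightarrow> 'a set \<Rightarrow> bool" where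
  "total_dominating_set G D \<longleftrightarrow>
     D \<subseteq> pverts G \<and> (\<forall>v \<in> pverts G. open_neighborhood G v \<inter> D \<noteq> {})"

text \<open>
  The minimum is attained exactly when there are no isolated vertices (see
  \<open>total_domination_number_attained\<close> below); otherwise the value is unspecified.
\<close>

definition total_domination_number :: "'a pair_pre_digraph \<Rightarrow> nat" where
  "total_domination_number G = (LEAST k. \<exists>D. total_dominating_set G D \<and> card D = k)"

text \<open>
  Vertices are tuples indexed by \<open>I\<close>, encoded as functions that are \<open>undefined\<close> outside \<open>I\<close>, so
  that equality of tuples is equality of functions. The common vertex type of the factors
  is no restriction: finite families of vertex types embed into their sum.
\<close>

definition cartesian_product ::
    "'i set \<Rightarrow> ('i \<Rightarrow> 'a pair_pre_digraph) \<Rightarrow> ('i \<Rightarrow> 'a) pair_pre_digraph" where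
  "cartesian_product I A =
     \<lparr> pverts = (\<Pi>\<^sub>E i\<in>I. pverts (A i)),
       parcs = {(u, v). u \<in> (\<Pi>\<^sub>E i\<in>I. pverts (A i)) \<and> v \<in> (\<Pi>\<^sub>E i\<in>I. pverts (A i)) \<and>
         (\<exists>i\<in>I. (u i, v i) \<in> parcs (A i) \<and> (\<forall>j\<in>I - {i}. u j = v j))} \<rparr>"

lemma cartesian_product_simps [simp]:
  "pverts (cartesian_product I A) = (\<Pi>\<^sub>E i\<in>I. pverts (A i))"
  "(u, v) \<in> parcs (cartesian_product I A) \<longleftrightarrow>
     u \<in> (\<Pi>\<^sub>E i\<in>I. pverts (A i)) \<and> v \<in> (\<Pi>\<^sub>E i\<in>I. pverts (A i)) \<and>
     (\<exists>i\<in>I. (u i, v i) \<in> parcs (A i) \<and> (\<forall>j\<in>I - {i}. u j = v j))"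
  by (simp_all add: cartesian_product_def)

lemma pair_graph_cartesian_product:
  assumes fin: "finite I" and graphs: "\<And>i. i \<in> I \<Longrightarrow> pair_graph (A i)"
  shows "pair_graph (cartesian_product I A)"
proof -
  let ?P = "cartesian_product I A"
  have sub: "parcs ?P \<subseteq> pverts ?P \<times> pverts ?P"
    by auto
  have "finite (pverts (A i))" if "i \<in> I" for i
    using graphs[OF that] by (simp add: pair_fin_digraph.pair_finite_verts
        pair_pseudo_graph.axioms(1) pair_graph.axioms(2))
  with fin have fv: "finite (pverts ?P)"
    by (simp add: finite_PiE)
  have fa: "finite (parcs ?P)"
    using fv by (rule finite_subset[OF sub finite_cartesian_product]) (rule fv)
  have symm: "(v i, u i) \<in> parcs (A i)" if "i \<in> I" "(u i, v i) \<in> parcs (A i)" for i u v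
    using pair_sym_digraph.arcs_symmetric[OF pair_pseudo_graph.axioms(2)[OF
          pair_graph.axioms(2)[OF graphs[OF that(1)]]] that(2)] .
  have loops: "u i \<noteq> v i" if "i \<in> I" "(u i, v i) \<in> parcs (A i)" for i u v
    using pair_loopfree_digraph.pair_no_loops[OF pair_digraph.axioms(2)[OF
          pair_graph.axioms(1)[OF graphs[OF that(1)]]] that(2)] by simp
  show ?thesis
  proof (unfold_locales)
    fix e assume e: "e \<in> parcs ?P"
    show "fst e \<in> pverts ?P" "snd e \<in> pverts ?P"
      using subsetD[OF sub e] by (simp_all only: mem_Times_iff)
    obtain u v where uv: "e = (u, v)" by (cases e)
    with e loops show "fst e \<noteq> snd e" by auto
  next
    show "symmetric (with_proj ?P)"
      unfolding symmetric_def with_proj_simps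
    proof (rule symI)
      fix u v assume "(u, v) \<in> parcs ?P"
      then obtain i where "u \<in> pverts ?P" "v \<in> pverts ?P" "i \<in> I" "(u i, v i) \<in> parcs (A i)"
        "\<forall>j\<in>I - {i}. u j = v j" by auto
      with symm[of i u v] show "(v, u) \<in> parcs ?P"
        unfolding cartesian_product_simps by (metis (no_types))
    qed
  qed (fact fv fa)+
qed

lemma no_isolated_vertices_cartesian_product:
  assumes "I \<noteq> {}" and "\<And>i. i \<in> I \<Longrightarrow> no_isolated_vertices (A i)"
  shows "no_isolated_vertices (cartesian_product I A)"
  unfolding no_isolated_vertices_def
proof
  fix u assume u: "u \<in> pverts (cartesian_product I A)"
  from \<open>I \<noteq> {}\<close> obtain i where i: "i \<in> I" by blast
  with u have "u i \<in> pverts (A i)" by auto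
  then obtain w where w: "w \<in> pverts (A i)" "(u i, w) \<in> parcs (A i)"
    using assms(2)[OF i] by (auto simp: no_isolated_vertices_def open_neighborhood_def)
  have "u(i := w) \<in> pverts (cartesian_product I A)"
    using u i w by (auto simp: PiE_iff extensional_def)
  moreover have "(u, u(i := w)) \<in> parcs (cartesian_product I A)"
    using u i w calculation by auto
  ultimately show "open_neighborhood (cartesian_product I A) u \<noteq> {}"
    unfolding open_neighborhood_def by blast
qed

lemma ex_total_dominating_set_iff:
  "(\<exists>D. total_dominating_set G D) \<longleftrightarrow> no_isolated_vertices G"
  unfolding total_dominating_set_def no_isolated_vertices_def open_neighborhood_def
  by (auto intro!: exI[of _ "pverts G"])

lemma total_domination_number_attained:
  assumes "no_isolated_vertices G"
  obtains D where "total_dominating_set G D" "card D = total_domination_number G"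
proof -
  from assms obtain D where "total_dominating_set G D"
    by (auto simp: ex_total_dominating_set_iff[symmetric])
  then have "\<exists>k. \<exists>D. total_dominating_set G D \<and> card D = k"
    by blast
  from LeastI_ex[OF this] show ?thesis
    using that unfolding total_domination_number_def by blast
qed

lemma total_domination_number_le:
  "total_dominating_set G D \<Longrightarrow> total_domination_number G \<le> card D"
  unfolding total_domination_number_def by (rule Least_le) blast

end

theory Submission
  imports Defs
begin

text \<open>
  Fix a minimum total dominating set \<open>T\<^sub>i\<close> of each factor and let \<open>c\<^sub>i\<close> send every vertex to a
  neighbor in \<open>T\<^sub>i\<close>. The fibers of the \<open>c\<^sub>i\<close> cut the vertex set of the product into \<open>\<Prod>\<^sub>i |T\<^sub>i|\<close>
  cells, one for each tuple \<open>t \<in> \<Prod>\<^sub>i T\<^sub>i\<close>. Let \<open>D\<close> be a total dominating set of the product. Each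
  cell has a direction \<open>j\<close> such that every \<open>x\<close> in its \<open>j\<close>-th side is adjacent to the \<open>j\<close>-th
  coordinate of an element of \<open>D\<close> whose other coordinates lie in the sides of the cell: otherwise
  counterexamples chosen in all directions form a vertex of the product that \<open>D\<close> does not dominate.
  On a line of cells in direction \<open>j\<close>, replacing the vertices of \<open>T\<^sub>j\<close> that belong to cells of type
  \<open>j\<close> by the projection of the part of \<open>D\<close> lying along the line gives a total dominating set
  of \<open>A\<^sub>j\<close>, so by minimality this part of \<open>D\<close> has at least as many elements as the line has
  cells of type \<open>j\<close>. Summing over the lines, at most \<open>|D|\<close> cells have type \<open>j\<close>, for each of the
  \<open>n\<close> directions.
\<close>

text \<open>This makes precise that the cell of \<open>t\<close> has type \<open>j\<close>. The
  \<open>j\<close>-th coordinate of \<open>d\<close> is not confined to the cell: \<open>d\<close>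
  may lie anywhere along the line through it.\<close>

definition dominated_along ::
    "'i set \<Rightarrow> ('i \<Rightarrow> 'a pair_pre_digraph) \<Rightarrow> ('i \<Rightarrow> 'a \<Rightarrow> 'a) \<Rightarrow> ('i \<Rightarrow> 'a) set \<Rightarrow> 'i \<Rightarrow> ('i \<Rightarrow> 'a) \<Rightarrow> bool"
  where
  "dominated_along I A c D j t \<longleftrightarrow>
     (\<forall>x \<in> pverts (A j). c j x = t j \<longrightarrow>
       (\<exists>d \<in> D. (x, d j) \<in> parcs (A j) \<and> (\<forall>k \<in> I - {j}. c k (d k) = t k)))"

lemma ex_dominated_along:
  assumes D: "total_dominating_set (cartesian_product I A) D"
  shows "\<exists>j \<in> I. dominated_along I A c D j t"
proof (rule ccontr)
  assume "\<not> ?thesis"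
  then have "\<forall>j \<in> I. \<exists>x. x \<in> pverts (A j) \<and> c j x = t j \<and>
      \<not> (\<exists>d \<in> D. (x, d j) \<in> parcs (A j) \<and> (\<forall>k \<in> I - {j}. c k (d k) = t k))"
    unfolding dominated_along_def by blast
  then obtain x where x: "\<And>j. j \<in> I \<Longrightarrow> x j \<in> pverts (A j)" "\<And>j. j \<in> I \<Longrightarrow> c j (x j) = t j"
      "\<And>j d. j \<in> I \<Longrightarrow> d \<in> D \<Longrightarrow> (x j, d j) \<in> parcs (A j) \<Longrightarrow> \<exists>k \<in> I - {j}. c k (d k) \<noteq> t k"
    by metis
  have "restrict x I \<in> pverts (cartesian_product I A)"
    using x(1) by simp
  then obtain d where "d \<in> D" "(restrict x I, d) \<in> parcs (cartesian_product I A)"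
    using D unfolding total_dominating_set_def open_neighborhood_def by blast
  then obtain j where "j \<in> I" "(x j, d j) \<in> parcs (A j)" "\<forall>k \<in> I - {j}. x k = d k"
    by auto
  \<comment> \<open>Off \<open>j\<close>, \<open>d\<close> agrees with \<open>x\<close>, so
    \<open>c k (d k) = t k\<close> there, against the choice of \<open>x j\<close>.\<close>
  with x(2,3) \<open>d \<in> D\<close> show False
    by (metis DiffD1)
qed

lemma card_line_dominated_along:
  assumes "j \<in> I" and "finite D" and "D \<subseteq> (\<Pi>\<^sub>E i\<in>I. pverts (A i))"
    and T: "T \<subseteq> pverts (A j)" "finite T" "card T = total_domination_number (A j)"
    and c: "\<And>x. x \<in> pverts (A j) \<Longrightarrow> c j x \<in> T \<and> (x, c j x) \<in> parcs (A j)"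
    and H: "\<And>t. t \<in> H \<Longrightarrow>
      t \<in> extensional I \<and> t j \<in> T \<and> dominated_along I A c D j t \<and> restrict t (I - {j}) = s"
  shows "card H \<le> card {d \<in> D. restrict (\<lambda>k. c k (d k)) (I - {j}) = s}" (is "_ \<le> card ?D")
proof -
  let ?L = "(\<lambda>t. t j) ` H"
  let ?E = "(\<lambda>d. d j) ` ?D \<union> (T - ?L)"
  have L: "?L \<subseteq> T"
    using H by blast
  \<comment> \<open>Cells on the line \<open>s\<close> differ only in coordinate \<open>j\<close>,
    so the vertices in \<open>?L\<close> count them.\<close>
  have "inj_on (\<lambda>t. t j) H"
  proof (rule inj_onI)
    fix t t' assume t: "t \<in> H" "t' \<in> H" "t j = t' j"
    then have "restrict t (I - {j}) = restrict t' (I - {j})"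
      using H by metis
    then have "t k = t' k" if "k \<in> I" for k
      using t(3) that by (cases "k = j") (auto dest: fun_cong[of _ _ k])
    moreover have "t \<in> extensional I" "t' \<in> extensional I"
      using H t by blast+
    ultimately show "t = t'"
      by (blast intro: extensionalityI)
  qed
  then have card_L: "card ?L = card H"
    by (rule card_image)
  have "total_dominating_set (A j) ?E"
    unfolding total_dominating_set_def
  proof (intro conjI ballI)
    show sub: "?E \<subseteq> pverts (A j)"
      using assms(1,3) T(1) by auto
    fix x assume x: "x \<in> pverts (A j)"
    \<comment> \<open>If \<open>c j x\<close> was removed from \<open>T\<close>, then
      \<open>x\<close> lies in the \<open>j\<close>-th side of a cell in \<open>H\<close>, whose
      type supplies \<open>d\<close>; otherwise \<open>c j x\<close> itself remains in
      \<open>?E\<close>.\<close>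
    have "\<exists>y \<in> ?E. (x, y) \<in> parcs (A j)"
    proof (cases "c j x \<in> ?L")
      case True
      then obtain t where t: "t \<in> H" "c j x = t j"
        by blast
      then obtain d where d: "d \<in> D" "(x, d j) \<in> parcs (A j)" "\<forall>k \<in> I - {j}. c k (d k) = t k"
        using H x unfolding dominated_along_def by blast
      have "restrict (\<lambda>k. c k (d k)) (I - {j}) = restrict t (I - {j})"
        using d(3) by (intro restrict_ext) blast
      with H t(1) d show ?thesis
        by auto
    next
      case False
      with c x show ?thesis
        by blast
    qed
    with sub show "open_neighborhood (A j) x \<inter> ?E \<noteq> {}"
      unfolding open_neighborhood_def by blast
  qed
  then have "card T \<le> card ?E"
    unfolding T(3) by (rule total_domination_number_le)
  also have "\<dots> \<le> card ?D + (card T - card H)"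
    using card_Un_le[of "(\<lambda>d. d j) ` ?D" "T - ?L"] card_image_le[of ?D "\<lambda>d. d j"]
      \<open>finite D\<close> card_Diff_subset[OF finite_subset[OF L T(2)] L] card_L
    by simp
  \<comment> \<open>Subtraction on \<open>nat\<close> truncates, so cancelling \<open>card T\<close>
    needs \<open>card H \<le> card T\<close>, which follows from
    \<open>?L \<subseteq> T\<close>.\<close>
  finally show ?thesis
    using card_mono[OF T(2) L] card_L by linarith
qed

lemma card_dominated_along:
  assumes "finite I" and j: "j \<in> I" and D: "finite D" "D \<subseteq> (\<Pi>\<^sub>E i\<in>I. pverts (A i))"
    and T: "\<And>i. i \<in> I \<Longrightarrow> T i \<subseteq> pverts (A i)" "\<And>i. i \<in> I \<Longrightarrow> finite (T i)"
      "card (T j) = total_domination_number (A j)"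
    and c: "\<And>i x. i \<in> I \<Longrightarrow> x \<in> pverts (A i) \<Longrightarrow> c i x \<in> T i \<and> (x, c i x) \<in> parcs (A i)"
  shows "card {t \<in> Pi\<^sub>E I T. dominated_along I A c D j t} \<le> card D" (is "card ?H \<le> _")
proof -
  let ?S = "Pi\<^sub>E (I - {j}) T"
  let ?p = "\<lambda>t. restrict t (I - {j})"
  let ?q = "\<lambda>d. restrict (\<lambda>k. c k (d k)) (I - {j})"
  have fin: "finite (Pi\<^sub>E I T)" "finite ?S"
    using \<open>finite I\<close> T(2) by (auto intro: finite_PiE)
  have "?p ` ?H \<subseteq> ?S"
    by (intro image_subsetI) (simp add: PiE_iff)
  then have "card ?H = (\<Sum>s \<in> ?S. card {t \<in> ?H. ?p t = s})"
    using sum.group[of ?H ?S ?p "\<lambda>_. 1::nat"] fin by simp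
  also have "\<dots> \<le> (\<Sum>s \<in> ?S. card {d \<in> D. ?q d = s})"
  proof (rule sum_mono)
    fix s
    show "card {t \<in> ?H. ?p t = s} \<le> card {d \<in> D. ?q d = s}"
    proof (rule card_line_dominated_along[where c = c, OF j D T(1)[OF j] T(2)[OF j] T(3)])
      show "c j x \<in> T j \<and> (x, c j x) \<in> parcs (A j)" if "x \<in> pverts (A j)" for x
        using c[OF j that] .
    next
      fix t assume "t \<in> {t \<in> ?H. ?p t = s}"
      with j show "t \<in> extensional I \<and> t j \<in> T j \<and> dominated_along I A c D j t \<and> ?p t = s"
        by (simp add: PiE_iff)
    qed
  qed
  also have "?q ` D \<subseteq> ?S"
  proof
    fix s assume "s \<in> ?q ` D"
    then obtain d where "d \<in> D" "s = ?q d"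
      by blast
    moreover from this have "d i \<in> pverts (A i)" if "i \<in> I" for i
      using D(2) that by blast
    ultimately show "s \<in> ?S"
      using c by simp
  qed
  \<comment> \<open>Each \<open>d\<close> lies along the single line \<open>?q d\<close>, so no
    element of \<open>D\<close> is counted twice.\<close>
  then have "(\<Sum>s \<in> ?S. card {d \<in> D. ?q d = s}) = card D"
    using sum.group[of D ?S ?q "\<lambda>_. 1::nat"] fin D(1) by simp
  finally show ?thesis .
qed

lemma prod_total_domination_number_le:
  assumes I: "finite I" "I \<noteq> {}"
    and fin: "\<And>i. i \<in> I \<Longrightarrow> finite (pverts (A i))"
    and iso: "\<And>i. i \<in> I \<Longrightarrow> no_isolated_vertices (A i)"
  shows "(\<Prod>i \<in> I. total_domination_number (A i))
           \<le> card I * total_domination_number (cartesian_product I A)"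
proof -
  have "\<forall>i \<in> I. \<exists>T. total_dominating_set (A i) T \<and> card T = total_domination_number (A i)"
    using iso by (metis total_domination_number_attained)
  then obtain T where T: "\<And>i. i \<in> I \<Longrightarrow> total_dominating_set (A i) (T i)"
      "\<And>i. i \<in> I \<Longrightarrow> card (T i) = total_domination_number (A i)"
    by metis
  have sub: "T i \<subseteq> pverts (A i)" if "i \<in> I" for i
    using T(1)[OF that] unfolding total_dominating_set_def by blast
  have fin_T: "finite (T i)" if "i \<in> I" for i
    using sub fin that finite_subset by blast
  have "\<forall>i x. \<exists>y. i \<in> I \<longrightarrow> x \<in> pverts (A i) \<longrightarrow> y \<in> T i \<and> (x, y) \<in> parcs (A i)"
    using T(1) unfolding total_dominating_set_def open_neighborhood_def by blast
  then obtain c where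
    c: "\<And>i x. i \<in> I \<Longrightarrow> x \<in> pverts (A i) \<Longrightarrow> c i x \<in> T i \<and> (x, c i x) \<in> parcs (A i)"
    by metis
  obtain D where D: "total_dominating_set (cartesian_product I A) D"
      "card D = total_domination_number (cartesian_product I A)"
    by (rule total_domination_number_attained[OF
          no_isolated_vertices_cartesian_product[OF I(2) iso]])
  have D_sub: "D \<subseteq> (\<Pi>\<^sub>E i\<in>I. pverts (A i))"
    using D(1) unfolding total_dominating_set_def by simp
  then have fin_D: "finite D"
    using I(1) fin by (meson finite_PiE finite_subset)
  have "(\<Prod>i \<in> I. total_domination_number (A i)) = card (Pi\<^sub>E I T)"
    using I(1) T(2) by (simp add: card_PiE)
  also have "Pi\<^sub>E I T = (\<Union>j \<in> I. {t \<in> Pi\<^sub>E I T. dominated_along I A c D j t})"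
    using ex_dominated_along[OF D(1), of c] by blast
  \<comment> \<open>A cell may have several types, hence only a union bound.\<close>
  also have "card \<dots> \<le> (\<Sum>j \<in> I. card {t \<in> Pi\<^sub>E I T. dominated_along I A c D j t})"
    by (rule card_UN_le[OF I(1)])
  also have "\<dots> \<le> (\<Sum>j \<in> I. card D)"
    using card_dominated_along[where c = c, OF I(1) _ fin_D D_sub sub fin_T T(2)] c
    by (intro sum_mono) blast
  finally show ?thesis
    using D(2) by simp
qed

theorem theorem3:
  fixes n :: nat and A :: "nat \<Rightarrow> 'a pair_pre_digraph"
  assumes "n \<ge> 1"
    and "\<And>i. i \<in> {1..n} \<Longrightarrow> pair_graph (A i)"
    and "\<And>i. i \<in> {1..n} \<Longrightarrow> no_isolated_vertices (A i)"
  shows "(\<Prod>i=1..n. total_domination_number (A i))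
           \<le> n * total_domination_number (cartesian_product {1..n} A)"
proof -
  have "finite (pverts (A i))" if "i \<in> {1..n}" for i
    using assms(2)[OF that] by (simp add: pair_fin_digraph.pair_finite_verts
        pair_pseudo_graph.axioms(1) pair_graph.axioms(2))
  then show ?thesis
    using prod_total_domination_number_le[of "{1..n}" A] assms(1,3) by simp
qed

end
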